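(* Let $A$ be a finite non-empty alphabet and let $\omega \in A^{\mathbb N}\cup A^{\mathbb Z}$ be a right-infinite or bi-infinite word over $A$. Then the Abelian complexity function $n\mapsto \rho^{\mathrm{ab}}_{\omega}(n)$ is bounded if and only if $\omega$ is $C$-balanced for some positive integer $C$.
   Context: $A$ is a finite non-empty alphabet. For a finite word $u$ and $a\in A$, $|u|_a$ is the number of occurrences of $a$ in $u$ and $|u|$ is the length of $u$. Two finite words $u,v$ are Abelian equivalent if $|u|_a=|v|_a$ for all $a\in A$. A factor of $\omega$ is a finite word occurring as a block of consecutive letters of $\omega$. The Abelian complexity $\rho^{\mathrm{ab}}_{\omega}(n)$ is the number of Abelian equivalence classes of factors of $\omega$ of length $n$. The word $\omega$ is $C$-balanced if $\bigl||U|_a-|V|_a\bigr|\le C$ for all $a\in A$ and all factors $U,V$ of $\omega$ of equal length. *)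

theory Defs
  imports Main "HOL-Library.FuncSet"
begin

text \<open>Finite words are lists; the number of occurrences of \<open>a\<close> in \<open>u\<close> is \<open>count_list u a\<close>.\<close>

datatype 'a infinite_word = Right_Infinite "nat \<Rightarrow> 'a" | Bi_Infinite "int \<Rightarrow> 'a"

definition infinite_words :: "'a set \<Rightarrow> 'a infinite_word set" where
  "infinite_words A = Right_Infinite ` (UNIV \<rightarrow> A) \<union> Bi_Infinite ` (UNIV \<rightarrow> A)"

text \<open>Both intervals below have length \<open>n\<close>; the empty word (\<open>n = 0\<close>) is a factor.\<close>

primrec factors :: "'a infinite_word \<Rightarrow> 'a list set" where
  "factors (Right_Infinite w) = {map w [i..<i + n] | i n. True}"
| "factors (Bi_Infinite w) = {map w [i..i + int n - 1] | i n. True}"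

definition abelian_equiv :: "'a set \<Rightarrow> ('a list \<times> 'a list) set" where
  "abelian_equiv A =
    {(u, v). u \<in> lists A \<and> v \<in> lists A \<and> (\<forall>a\<in>A. count_list u a = count_list v a)}"

text \<open>The quotient consists of the equivalence classes that contain a factor of length \<open>n\<close>.
  For a finite alphabet there are finitely many of them, so \<open>card\<close> has its usual meaning.\<close>

definition abelian_complexity :: "'a set \<Rightarrow> 'a infinite_word \<Rightarrow> nat \<Rightarrow> nat" where
  "abelian_complexity A \<omega> n = card ({u \<in> factors \<omega>. length u = n} // abelian_equiv A)"

definition balanced :: "'a set \<Rightarrow> nat \<Rightarrow> 'a infinite_word \<Rightarrow> bool" where
  "balanced A C \<omega> \<longleftrightarrow>
    (\<forall>a\<in>A. \<forall>U\<in>factors \<omega>. \<forall>V\<in>factors \<omega>. length U = length V \<longrightarrow>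
      \<bar>int (count_list U a) - int (count_list V a)\<bar> \<le> int C)"

end

theory Submission
  imports Defs
begin

text \<open>
  For each length \<open>n\<close> the Abelian classes of factors correspond to their Parikh vectors, the
  functions sending a letter to its number of occurrences. Both directions compare the number of
  these vectors with the spread of a single coordinate.

  If the word is \<open>C\<close>-balanced, all Parikh vectors for a given \<open>n\<close> lie in a box around any one of
  them, with at most \<open>2 * C + 1\<close> values per letter, so there are at most
  \<open>(2 * C + 1) ^ card A\<close> of them, whatever \<open>n\<close> is (\<open>card_parikh_le_if_balanced\<close>).

  Conversely, sliding a window of length \<open>n\<close> along the word by one place drops one letter and
  appends one, so the number of occurrences of a fixed letter moves by at most one. By the discrete
  intermediate value theorem, every value between \<open>|U|\<^sub>a\<close> and \<open>|V|\<^sub>a\<close> is attained by some factor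
  (\<open>factor_with_intermediate_count\<close>). Different values belong to different Parikh vectors, hence a
  bound on the number of classes is a bound on the difference.
\<close>

section \<open>Parikh vectors\<close>

definition parikh :: "'a set \<Rightarrow> 'a list \<Rightarrow> 'a \<Rightarrow> nat" where
  "parikh A u = restrict (count_list u) A"

lemma parikh_eq_iff: "parikh A u = parikh A v \<longleftrightarrow> (\<forall>a\<in>A. count_list u a = count_list v a)"
  by (auto simp: parikh_def restrict_def fun_eq_iff)

lemma card_image_eq_if_same_fibres:
  assumes "\<And>x y. x \<in> X \<Longrightarrow> y \<in> X \<Longrightarrow> f x = f y \<longleftrightarrow> g x = g y"
  shows "card (f ` X) = card (g ` X)"
proof -
  let ?h = "\<lambda>y. g (inv_into X f y)"
  have h: "?h (f x) = g x" if "x \<in> X" for x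
    using assms[of "inv_into X f (f x)" x] that by (simp add: inv_into_into f_inv_into_f)
  then have "inj_on ?h (f ` X)"
    using assms by (auto simp: inj_on_def)
  moreover have "?h ` f ` X = g ` X"
    using h by (auto simp: image_image)
  ultimately show ?thesis
    by (metis card_image)
qed

lemma card_abelian_classes_eq_card_parikh:
  assumes "X \<subseteq> lists A"
  shows "card (X // abelian_equiv A) = card (parikh A ` X)"
proof -
  have "X // abelian_equiv A = (\<lambda>u. abelian_equiv A `` {u}) ` X"
    by (auto simp: quotient_def)
  moreover have "abelian_equiv A `` {u} = abelian_equiv A `` {v} \<longleftrightarrow> parikh A u = parikh A v"
    if "u \<in> X" "v \<in> X" for u v
  proof
    assume "abelian_equiv A `` {u} = abelian_equiv A `` {v}"
    moreover have "v \<in> abelian_equiv A `` {v}"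
      using that assms by (auto simp: abelian_equiv_def)
    ultimately show "parikh A u = parikh A v"
      by (auto simp: parikh_eq_iff abelian_equiv_def)
  next
    assume "parikh A u = parikh A v"
    then show "abelian_equiv A `` {u} = abelian_equiv A `` {v}"
      using that assms by (auto simp: parikh_eq_iff abelian_equiv_def)
  qed
  ultimately show ?thesis
    using card_image_eq_if_same_fibres[of X "\<lambda>u. abelian_equiv A `` {u}" "parikh A"] by simp
qed

section \<open>Factors as windows\<close>

lemma map_int_upt: "map int [i..<i + n] = [int i..int i + int n - 1]"
  by (rule nth_equalityI) auto

text \<open>
  A right-infinite word is treated as a word indexed by the integers in which only windows with a
  non-negative starting position count. Of the set of admissible positions only convexity matters:
  it allows a window to slide from one position to another without leaving the word.
\<close>

lemma factors_as_windows:
  obtains x :: "int \<Rightarrow> 'a" and S :: "int set"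
  where "factors \<omega> = {map x [i..i + int n - 1] | i n. i \<in> S}"
    and "\<And>i j k. i \<in> S \<Longrightarrow> k \<in> S \<Longrightarrow> i \<le> j \<Longrightarrow> j \<le> k \<Longrightarrow> j \<in> S"
proof (cases \<omega>)
  case (Right_Infinite w)
  have win: "map w [i..<i + n] = map (\<lambda>j. w (nat j)) [int i..int i + int n - 1]" for i n
    unfolding map_int_upt[symmetric] by simp
  have "factors \<omega> = {map (\<lambda>j. w (nat j)) [i..i + int n - 1] | i n. i \<in> {0..}}"
    unfolding Right_Infinite factors.simps win
  proof (intro Collect_cong iffI; elim exE conjE)
    fix u i n
    assume "u = map (\<lambda>j. w (nat j)) [int i..int i + int n - 1]"
    then show "\<exists>i n. u = map (\<lambda>j. w (nat j)) [i..i + int n - 1] \<and> i \<in> {0..}"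
      by (intro exI[of _ "int i"] exI[of _ n]) simp
  next
    fix u i n
    assume "u = map (\<lambda>j. w (nat j)) [i..i + int n - 1]" "i \<in> {0..}"
    then show "\<exists>i n. u = map (\<lambda>j. w (nat j)) [int i..int i + int n - 1] \<and> True"
      by (intro exI[of _ "nat i"] exI[of _ n]) simp
  qed
  then show thesis
    by (rule that) auto
next
  case (Bi_Infinite w)
  show thesis
    by (rule that[of w UNIV]) (auto simp: Bi_Infinite)
qed

lemma count_window_shift:
  "\<bar>int (count_list (map x [i + 1..i + 1 + int n - 1]) a)
     - int (count_list (map x [i..i + int n - 1]) a)\<bar> \<le> 1"
proof (cases n)
  case (Suc m)
  have "[i..i + int n - 1] = i # [i + 1..i + int m]"
    using Suc by (simp add: upto_rec1)
  moreover have "[i + 1..i + 1 + int n - 1] = [i + 1..i + int m] @ [i + 1 + int m]"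
    using Suc upto_rec2[of "i + 1" "i + 1 + int m"] by (simp add: add_ac)
  ultimately show ?thesis
    by simp
qed simp

text \<open>
  The window may have to slide in either direction, since the factor with fewer occurrences may
  begin to the right of the other one; the sign \<open>s\<close> below covers both cases at once.
\<close>

lemma factor_with_intermediate_count:
  assumes U: "U \<in> factors \<omega>" and V: "V \<in> factors \<omega>" and len: "length U = length V"
    and t: "count_list U a \<le> t" "t \<le> count_list V a"
  obtains W where "W \<in> factors \<omega>" "length W = length U" "count_list W a = t"
proof -
  obtain x :: "int \<Rightarrow> 'a" and S
    where fac: "factors \<omega> = {map x [i..i + int n - 1] | i n. i \<in> S}"
      and conv: "\<And>i j k. i \<in> S \<Longrightarrow> k \<in> S \<Longrightarrow> i \<le> j \<Longrightarrow> j \<le> k \<Longrightarrow> j \<in> S"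
    by (rule factors_as_windows[of \<omega>]) blast
  define n where "n = length U"
  define win where "win i = map x [i..i + int n - 1]" for i
  obtain i where i: "i \<in> S" "U = win i"
    using U unfolding fac win_def n_def by fastforce
  obtain j where j: "j \<in> S" "V = win j"
    using V len unfolding fac win_def n_def by fastforce
  define s :: int where "s = (if i \<le> j then 1 else - 1)"
  define m where "m = nat \<bar>j - i\<bar>"
  define f where "f k = int (count_list (win (i + s * int k)) a)" for k
  have step: "\<bar>f (Suc k) - f k\<bar> \<le> 1" for k
  proof (cases "i \<le> j")
    case True
    then show ?thesis
      using count_window_shift[of x "i + int k" n a]
      by (simp add: f_def s_def win_def algebra_simps)
  next
    case False
    then show ?thesis
      using count_window_shift[of x "i - int (Suc k)" n a]
      by (simp add: f_def s_def win_def algebra_simps abs_minus_commute)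
  qed
  have m: "i + s * int m = j"
    by (auto simp: s_def m_def)
  have "\<exists>k. 0 \<le> k \<and> k \<le> m \<and> f k = int t"
  proof (rule nat_intermed_int_val)
    show "f 0 \<le> int t" "int t \<le> f m"
      using t i j m by (simp_all add: f_def)
  qed (use step in auto)
  then obtain k where k: "k \<le> m" "f k = int t"
    by blast
  have "i + s * int k \<in> S"
  proof (cases "i \<le> j")
    case True
    then show ?thesis
      using conv[OF i(1) j(1), of "i + s * int k"] k(1) by (auto simp: s_def m_def)
  next
    case False
    then show ?thesis
      using conv[OF j(1) i(1), of "i + s * int k"] k(1) by (auto simp: s_def m_def)
  qed
  then have "win (i + s * int k) \<in> factors \<omega>"
    unfolding fac win_def by blast
  moreover have "length (win (i + s * int k)) = length U"
    by (simp add: win_def n_def)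
  moreover have "count_list (win (i + s * int k)) a = t"
    using k(2) by (simp add: f_def)
  ultimately show thesis
    by (rule that)
qed

lemma factors_subset_lists:
  assumes "\<omega> \<in> infinite_words A"
  shows "factors \<omega> \<subseteq> lists A"
  using assms by (auto simp: infinite_words_def Pi_iff)

section \<open>Counting Parikh vectors\<close>

lemma card_parikh_le_if_balanced:
  assumes "finite A" and bal: "balanced A C \<omega>"
  shows "card (parikh A ` {u \<in> factors \<omega>. length u = n}) \<le> (2 * C + 1) ^ card A"
proof (cases "{u \<in> factors \<omega>. length u = n} = {}")
  case False
  then obtain v where v: "v \<in> factors \<omega>" "length v = n"
    by blast
  let ?B = "\<Pi>\<^sub>E a\<in>A. {count_list v a - C..count_list v a + C}"
  have "parikh A u \<in> ?B" if u: "u \<in> factors \<omega>" "length u = n" for u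
  proof -
    have "count_list u a \<in> {count_list v a - C..count_list v a + C}" if "a \<in> A" for a
    proof -
      have "\<bar>int (count_list u a) - int (count_list v a)\<bar> \<le> int C"
        using bal that u v by (auto simp: balanced_def)
      then show ?thesis
        by auto
    qed
    then show ?thesis
      by (auto simp: parikh_def)
  qed
  then have "card (parikh A ` {u \<in> factors \<omega>. length u = n}) \<le> card ?B"
    using \<open>finite A\<close> by (intro card_mono finite_PiE) auto
  also have "\<dots> = (\<Prod>a\<in>A. card {count_list v a - C..count_list v a + C})"
    using \<open>finite A\<close> by (rule card_PiE)
  \<comment> \<open>Truncated subtraction can only make the intervals shorter.\<close>
  also have "\<dots> \<le> (\<Prod>a\<in>A. 2 * C + 1)"
    by (rule prod_mono) auto
  finally show ?thesis
    by simp
qed (simp only: image_empty card.empty le0)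

lemma count_diff_less_card_parikh:
  assumes "finite A" "a \<in> A" and fac: "factors \<omega> \<subseteq> lists A"
    and U: "U \<in> factors \<omega>" "length U = n" and V: "V \<in> factors \<omega>" "length V = n"
  shows "count_list V a - count_list U a
    < card (parikh A ` {u \<in> factors \<omega>. length u = n})"
proof -
  let ?F = "{u \<in> factors \<omega>. length u = n}"
  have "?F \<subseteq> {u. set u \<subseteq> A \<and> length u = n}"
    using fac by (auto simp: in_lists_conv_set)
  then have fin: "finite ?F"
    using finite_lists_length_eq[OF \<open>finite A\<close>] finite_subset by blast
  show ?thesis
  proof (cases "count_list U a \<le> count_list V a")
    case True
    have "{count_list U a..count_list V a} \<subseteq> (\<lambda>p. p a) ` parikh A ` ?F"
    proof
      fix t
      assume "t \<in> {count_list U a..count_list V a}"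
      then obtain W where "W \<in> ?F" "count_list W a = t"
        using factor_with_intermediate_count[of U \<omega> V a t] U V by auto
      then have "W \<in> ?F" "t = parikh A W a"
        using \<open>a \<in> A\<close> by (simp_all add: parikh_def)
      then show "t \<in> (\<lambda>p. p a) ` parikh A ` ?F"
        by blast
    qed
    then have "card {count_list U a..count_list V a} \<le> card (parikh A ` ?F)"
      by (rule surj_card_le[rotated]) (rule finite_imageI[OF fin])
    then show ?thesis
      using True by simp
  next
    case False
    have "0 < card (parikh A ` ?F)"
      using fin U by (auto simp: card_gt_0_iff)
    then show ?thesis
      using False by simp
  qed
qed

theorem lemma3:
  fixes A :: "'a set" and \<omega> :: "'a infinite_word"
  assumes "finite A" and "A \<noteq> {}"
    and "\<omega> \<in> infinite_words A"
  shows "bdd_above (range (\<lambda>n. abelian_complexity A \<omega> n)) \<longleftrightarrow> (\<exists>C>0. balanced A C \<omega>)"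
proof -
  have fac: "factors \<omega> \<subseteq> lists A"
    using assms(3) by (rule factors_subset_lists)
  have compl: "abelian_complexity A \<omega> n
      = card (parikh A ` {u \<in> factors \<omega>. length u = n})" for n
    unfolding abelian_complexity_def
    by (rule card_abelian_classes_eq_card_parikh) (use fac in auto)
  show ?thesis
  proof
    assume "bdd_above (range (\<lambda>n. abelian_complexity A \<omega> n))"
    then obtain K where K: "abelian_complexity A \<omega> n \<le> K" for n
      by (auto simp: bdd_above_def)
    have diff: "count_list V a - count_list U a < K"
      if "a \<in> A" "U \<in> factors \<omega>" "V \<in> factors \<omega>" "length U = length V" for a U V
      using count_diff_less_card_parikh[OF assms(1) that(1) fac that(2) refl that(3)]
        that(4) K[of "length U"] by (simp add: compl)
    \<comment> \<open>The successor only serves to make the constant positive.\<close>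
    have "balanced A (Suc K) \<omega>"
      unfolding balanced_def
    proof (intro ballI impI)
      fix a U V
      assume *: "a \<in> A" "U \<in> factors \<omega>" "V \<in> factors \<omega>" "length U = length V"
      show "\<bar>int (count_list U a) - int (count_list V a)\<bar> \<le> int (Suc K)"
        using diff[OF *] diff[OF *(1,3,2) *(4)[symmetric]] by linarith
    qed
    then show "\<exists>C>0. balanced A C \<omega>"
      by blast
  next
    assume "\<exists>C>0. balanced A C \<omega>"
    then obtain C where "balanced A C \<omega>"
      by blast
    then have "abelian_complexity A \<omega> n \<le> (2 * C + 1) ^ card A" for n
      unfolding compl by (rule card_parikh_le_if_balanced[OF assms(1)])
    then show "bdd_above (range (\<lambda>n. abelian_complexity A \<omega> n))"
      by (auto simp: bdd_above_def)
  qed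
qed

end
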